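(* Let $a \in \mathbf{F}_q$ be a nonzero element that is a square in $\mathbf{F}_q$, and let $\sqrt{a}\in \mathbf{F}_q$ denote a square root of $a$. Let $f(x) \in \mathbf{F}_q[x]$ be a nontrivial $a$-self reciprocal monic polynomial of degree $n=2m$. If $f(x)$ is not divisible by $x^2-a$ and $f(\sqrt{a})=0$, then $f(x)$ can be written as $f(x) = (x-\sqrt{a})^k\cdot g(x)$, where $k$ is even and $g(x) \in \mathbf{F}_q[x]$ is a nontrivial $a$-self reciprocal monic polynomial with $g(\sqrt{a}) \neq 0$.
   Context: Let $q=p^e$ be an odd prime power and $\mathbf{F}_q$ the finite field with $q$ elements. For a nonzero $a\in\mathbf{F}_q$ and a monic polynomial $f(x)=\sum_{i=0}^n b_i x^i \in \mathbf{F}_q[x]$ of degree $n$ with $f(0)\neq 0$, the $a$-reciprocal of $f$ is $\hat{f}_a(x) := \frac{x^n}{f(0)} f\left(\frac{a}{x}\right) = \frac{1}{b_0}\sum_{i=0}^n b_i a^i x^{n-i}$. A monic polynomial $f(x)$ (with $f(0)\ne 0$) is $a$-self reciprocal if $\hat{f}_a(x)=f(x)$; comparing coefficients gives $b_0^2=a^n$. An $a$-self reciprocal monic polynomial of even degree $n=2m$ ($m\ge 0$) is called trivial if $b_0=-a^m$ and nontrivial if $b_0=a^m$. In particular the constant polynomial $1$ (degree $0$) counts as a nontrivial $a$-self reciprocal monic polynomial. *)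

theory Defs
  imports "HOL-Computational_Algebra.Computational_Algebra" "HOL-Library.Cardinality"
begin

text \<open>
  The expression \<open>x ^ n / f(0) * f(a / x)\<close>, written out as the polynomial
  \<open>1 / b_0 * (\<Sum>i\<le>n. b_i * a ^ i * x ^ (n - i))\<close>. It is only meaningful for
  \<open>coeff f 0 \<noteq> 0\<close>, which the predicates below require.
\<close>

definition reciprocal :: "'a::field \<Rightarrow> 'a poly \<Rightarrow> 'a poly" where
  "reciprocal a f =
     smult (1 / coeff f 0) (\<Sum>i\<le>degree f. monom (coeff f i * a ^ i) (degree f - i))"

definition self_reciprocal :: "'a::field \<Rightarrow> 'a poly \<Rightarrow> bool" where
  "self_reciprocal a f \<longleftrightarrow> lead_coeff f = 1 \<and> coeff f 0 \<noteq> 0 \<and> reciprocal a f = f"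

definition nontrivial_self_reciprocal :: "'a::field \<Rightarrow> 'a poly \<Rightarrow> bool" where
  "nontrivial_self_reciprocal a f \<longleftrightarrow>
     self_reciprocal a f \<and> (\<exists>m. degree f = 2 * m \<and> coeff f 0 = a ^ m)"

text \<open>
  Polynomial identities over a finite field are not determined by evaluation, so the
  following only confirms the formula; it does not characterise \<^const>\<open>reciprocal\<close>.
\<close>

lemma poly_reciprocal:
  assumes "x \<noteq> 0"
  shows "poly (reciprocal a f) x = x ^ degree f / poly f 0 * poly f (a / x)"
proof -
  have "a ^ i * x ^ (degree f - i) = x ^ degree f * (a / x) ^ i" if "i \<le> degree f" for i
    using assms that by (simp add: power_diff power_divide field_simps)
  then have "(\<Sum>i\<le>degree f. coeff f i * (a ^ i * x ^ (degree f - i)))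
      = (\<Sum>i\<le>degree f. coeff f i * (x ^ degree f * (a / x) ^ i))"
    by (intro sum.cong) auto
  then show ?thesis
    by (simp add: reciprocal_def poly_sum poly_monom poly_altdef[of f "a / x"] poly_0_coeff_0
        sum_distrib_left sum_divide_distrib mult_ac)
qed

lemma nontrivial_self_reciprocal_1: "nontrivial_self_reciprocal a 1"
  by (simp add: nontrivial_self_reciprocal_def self_reciprocal_def reciprocal_def monom_0 one_pCons)

end

theory Submission
  imports Defs
begin

text \<open>
  Since \<open>x - s\<close> is its own \<open>a\<close>-reciprocal and taking \<open>a\<close>-reciprocals is multiplicative, the
  cofactor \<open>g\<close> of the full power \<open>(x - s) ^ k\<close> in \<open>f\<close> is again \<open>a\<close>-self reciprocal. Evaluating
  its self reciprocity at the fixed point \<open>s\<close> of \<open>x \<mapsto> a / x\<close> gives \<open>g(0) = s ^ deg g\<close>. On the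
  other hand \<open>f(0) = s ^ deg f\<close> forces \<open>g(0) = (-1) ^ k * s ^ deg g\<close>, so \<open>k\<close> is even as the
  characteristic is odd.
\<close>

text \<open>Prepares multiplicativity: substitution, \<open>reflect_poly\<close> and the constant
  coefficient all respect products. As \<open>a\<close> is nonzero, substituting
  \<open>a * x\<close> preserves the degree, so the reflection is about
  \<open>degree f\<close>.\<close>

lemma reciprocal_altdef:
  assumes "a \<noteq> 0"
  shows "reciprocal a f = smult (1 / coeff f 0) (reflect_poly (f \<circ>\<^sub>p [:0, a:]))"
proof -
  have "(\<Sum>i\<le>degree f. monom (coeff f i * a ^ i) (degree f - i)) = reflect_poly (f \<circ>\<^sub>p [:0, a:])"
  proof (rule poly_eqI)
    fix j
    \<comment> \<open>Solving for \<open>i\<close> leaves at most one term; the guard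
      \<open>j \<le> degree f\<close> is needed because subtraction truncates.\<close>
    have "(\<Sum>i\<le>degree f. if degree f - i = j then coeff f i * a ^ i else 0) =
          (\<Sum>i\<le>degree f. if j \<le> degree f \<and> i = degree f - j then coeff f i * a ^ i else 0)"
      by (intro sum.cong) auto
    also have "\<dots> = (if j \<le> degree f then coeff f (degree f - j) * a ^ (degree f - j) else 0)"
      by auto
    finally show "coeff (\<Sum>i\<le>degree f. monom (coeff f i * a ^ i) (degree f - i)) j =
        coeff (reflect_poly (f \<circ>\<^sub>p [:0, a:])) j"
      using assms by (simp add: coeff_sum coeff_reflect_poly coeff_pcompose_linear degree_pcompose
          mult.commute)
  qed
  then show ?thesis
    by (simp add: reciprocal_def)
qed

lemma reciprocal_mult:
  assumes "a \<noteq> 0"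
  shows "reciprocal a (f * g) = reciprocal a f * reciprocal a g"
  using assms
  by (simp add: reciprocal_altdef pcompose_mult reflect_poly_mult coeff_mult_0 mult_ac)

lemma reciprocal_power:
  assumes "a \<noteq> 0"
  shows "reciprocal a (f ^ k) = reciprocal a f ^ k"
proof (induction k)
  case 0
  show ?case
    by (simp add: reciprocal_def monom_0 one_pCons)
next
  case (Suc k)
  then show ?case
    using assms by (simp add: reciprocal_mult)
qed

text \<open>Before scaling, the sum is \<open>- s * x + s\<^sup>2\<close>; dividing by the constant
  coefficient \<open>- s\<close> returns \<open>x - s\<close>.\<close>

lemma reciprocal_linear_root:
  assumes "s \<noteq> 0"
  shows "reciprocal (s\<^sup>2) [:- s, 1:] = [:- s, 1:]"
  using assms by (simp add: reciprocal_def monom_altdef power2_eq_square)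

lemma self_reciprocal_coeff_0:
  assumes "s \<noteq> 0" and "self_reciprocal (s\<^sup>2) g" and "poly g s \<noteq> 0"
  shows "coeff g 0 = s ^ degree g"
proof -
  have "poly g s = s ^ degree g / coeff g 0 * poly g s"
    using assms poly_reciprocal[OF assms(1), of "s\<^sup>2" g]
    by (simp add: self_reciprocal_def power2_eq_square poly_0_coeff_0)
  then show ?thesis
    using assms by (simp add: self_reciprocal_def field_simps)
qed

text \<open>Translation by 1 permutes the ring, so adding 1 to every element leaves the sum of all
  elements unchanged.\<close>

lemma of_nat_card_eq_0: "of_nat CARD('a) = (0 :: 'a :: {ring_1, finite})"
proof -
  have "bij (\<lambda>x :: 'a. x + 1)"
    by (rule bij_betw_byWitness[where f' = "\<lambda>x. x - 1"]) auto
  then have "(\<Sum>x\<in>(UNIV :: 'a set). x + 1) = (\<Sum>x\<in>UNIV. x)"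
    by (rule sum.reindex_bij_betw)
  then show ?thesis
    by (simp add: sum.distrib)
qed

text \<open>If 2 vanished, an odd cardinality would have image 1 in the ring, but its image is
  0.\<close>

lemma two_neq_zero_if_odd_card:
  assumes "odd CARD('a :: {comm_ring_1, finite})"
  shows "(2 :: 'a) \<noteq> 0"
proof
  assume two: "(2 :: 'a) = 0"
  obtain c where "CARD('a) = 2 * c + 1"
    using assms(1) by (elim oddE)
  then have "(of_nat CARD('a) :: 'a) = 2 * of_nat c + 1"
    by simp
  then show False
    using two by (simp only: of_nat_card_eq_0) simp
qed

theorem theorem4:
  fixes a s :: "'a :: {field, finite}"
    and f :: "'a poly"
    and p e m :: nat
  assumes "prime p" and "odd p" and "e > 0" and "CARD('a) = p ^ e"
    and "a \<noteq> 0" and "s\<^sup>2 = a"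
    and "nontrivial_self_reciprocal a f" and "degree f = 2 * m"
    and "\<not> [:- a, 0, 1:] dvd f"
    and "poly f s = 0"
  shows "\<exists>k g. f = [:- s, 1:] ^ k * g \<and> even k \<and>
           nontrivial_self_reciprocal a g \<and> poly g s \<noteq> 0"
proof -
  have s: "s \<noteq> 0"
    using assms(5,6) by auto
  have two: "(2 :: 'a) \<noteq> 0"
    using assms(2,4) by (intro two_neq_zero_if_odd_card) simp
  \<comment> \<open>The exponent in the definition of nontriviality is \<open>m\<close>, as both are
    half of \<open>degree f\<close>.\<close>
  have f: "lead_coeff f = 1" "coeff f 0 \<noteq> 0" "reciprocal a f = f" "coeff f 0 = a ^ m"
    using assms(7,8) by (auto simp: nontrivial_self_reciprocal_def self_reciprocal_def)
  then have "f \<noteq> 0"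
    by auto
  define k where "k = order s f"
  obtain g where g: "f = [:- s, 1:] ^ k * g" and "\<not> [:- s, 1:] dvd g"
    using order_decomp[OF \<open>f \<noteq> 0\<close>] unfolding k_def by blast
  then have gs: "poly g s \<noteq> 0"
    by (simp add: poly_eq_0_iff_dvd)
  have "g \<noteq> 0"
    using g \<open>f \<noteq> 0\<close> by auto
  have deg: "2 * m = k + degree g"
    using g \<open>g \<noteq> 0\<close> assms(8) by (simp add: degree_mult_eq degree_power_eq)
  \<comment> \<open>Both sides are \<open>f\<close>, the left one in the form
    \<open>reciprocal a f\<close>; the nonzero power then cancels.\<close>
  have "[:- s, 1:] ^ k * reciprocal a g = [:- s, 1:] ^ k * g"
    using f(3) assms(5,6) s g
    by (metis reciprocal_mult reciprocal_power reciprocal_linear_root)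
  then have "reciprocal a g = g"
    by simp
  moreover have "lead_coeff g = 1"
    using f(1) g by (simp add: lead_coeff_mult lead_coeff_power)
  moreover have g0: "(- s) ^ k * coeff g 0 = s ^ (2 * m)"
    using f(4) g assms(6) by (simp add: coeff_mult_0 coeff_0_power power_mult)
  then have "coeff g 0 \<noteq> 0"
    using s by auto
  ultimately have sr: "self_reciprocal a g"
    by (simp add: self_reciprocal_def)
  then have c: "coeff g 0 = s ^ degree g"
    using self_reciprocal_coeff_0 s gs assms(6) by blast
  have "even k"
  proof (rule ccontr)
    assume "odd k"
    \<comment> \<open>For odd \<open>k\<close>, the left side of \<open>g0\<close> is
      \<open>- (s ^ k * s ^ degree g)\<close>, and the exponents add up to
      \<open>2 * m\<close>.\<close>
    then have "- (s ^ (2 * m)) = s ^ (2 * m)"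
      using g0 c deg by (simp add: power_add)
    then have "2 * s ^ (2 * m) = 0"
      by (metis add.left_inverse mult_2)
    then show False
      using two s by simp
  qed
  then obtain d where d: "degree g = 2 * d"
    using deg by (metis dvd_add_right_iff dvd_triv_left dvdE)
  then have "coeff g 0 = a ^ d"
    using c assms(6) by (simp add: power_mult)
  then show ?thesis
    using g \<open>even k\<close> sr d gs by (auto simp: nontrivial_self_reciprocal_def)
qed

end
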